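(* Let $\tilde S\subseteq\mathbb{R}^d$ be a (possibly random) nonempty finite candidate support set. Suppose there exists $\alpha\ge 0$ such that, for every choice of points $\bm{x}_i\in\Xi_i$, $i\in[k]$, $$\mathbb{E}_{\tilde S}\Big[\min_{\bm{w}\in\tilde S}\sum_{i\in[k]}\lambda_i\|\bm{w}-\bm{x}_i\|_2^2\Big]\le(1+\alpha)\min_{\bm{w}\in\mathbb{R}^d}\sum_{i\in[k]}\lambda_i\|\bm{w}-\bm{x}_i\|_2^2 .$$ Then $\mathbb{E}_{\tilde S}[v(\tilde S)]\le(1+\alpha)\,v(S^* )$.
   Context: Notation: $[k]=\{1,\dots,k\}$. For $i\in[k]$, $\mathbb{P}_i=\sum_{j\in[|\Xi_i|]}\hat p_{ij}\delta_{\hat{\bm{x}}_{ij}}$ is a probability measure supported on a nonempty finite set $\Xi_i=\{\hat{\bm{x}}_{ij}\}_j\subseteq\mathbb{R}^d$ with $|\Xi_i|\le n$. Weights $\bm\lambda=(\lambda_1,\dots,\lambda_k)$ satisfy $\lambda_i\ge0$ and $\sum_{i\in[k]}\lambda_i=1$. For a nonempty finite set $S\subseteq\mathbb{R}^d$ and a multi-index $\vec{\bm{j}}=(j_1,\dots,j_k)$ with $j_i\in[|\Xi_i|]$, put $C_{\vec{\bm{j}}}(S)=\min_{\bm{w}\in S}\sum_{i\in[k]}\lambda_i\|\hat{\bm{x}}_{i,j_i}-\bm{w}\|_2^2$, and define the restricted value $$v(S)=\max_{\bm\gamma}\Big\{\sum_{i\in[k]}\sum_{j\in[|\Xi_i|]}\hat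 p_{ij}\gamma_{ij}:\ C_{\vec{\bm{j}}}(S)-\sum_{i\in[k]}\gamma_{ij_i}\ge0\ \ \forall\,\vec{\bm{j}}\in\prod_{i\in[k]}[|\Xi_i|]\Big\}.$$ This is the linear-programming dual of (and has the same value as) the restricted multi-marginal optimal transport problem of minimizing $\sum_{\vec{\bm{j}}}C_{\vec{\bm{j}}}(S)\Pi_{\vec{\bm{j}}}$ over nonnegative tensors $\bm\Pi$ whose $i$-th marginal is $(\hat p_{ij})_j$ for every $i\in[k]$. The exact candidate support is $S^*=\bigcup_{\bm{x}_i\in\Xi_i,\,i\in[k]}\{\arg\min_{\bm{w}\in\mathbb{R}^d}\sum_{i\in[k]}\lambda_i\|\bm{x}_i-\bm{w}\|_2^2\}=\{\sum_{i\in[k]}\lambda_i\bm{x}_i:\bm{x}_i\in\Xi_i\}$. If $\tilde S$ is random, the expectation is over its distribution (the quantities involved are assumed measurable). *)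

theory Defs
  imports "HOL-Probability.Probability"
begin

definition bary_cost ::
  "nat \<Rightarrow> (nat \<Rightarrow> real) \<Rightarrow> (nat \<Rightarrow> real ^ 'd) \<Rightarrow> real ^ 'd \<Rightarrow> real" where
  "bary_cost k lam y w = (\<Sum>i\<in>{1..k}. lam i * (norm (y i - w))\<^sup>2)"

text \<open>
  The support of the \<open>i\<close>-th measure is the set \<open>Xi i\<close>, enumerated by \<open>x i 1\<close>, \dots,
  \<open>x i (card (Xi i))\<close>; the point \<open>x i j\<close> carries the mass \<open>p i j\<close>.
  Multi-indices are the elements of \<open>multi_indices k Xi\<close>.
\<close>

definition multi_indices :: "nat \<Rightarrow> (nat \<Rightarrow> (real ^ 'd) set) \<Rightarrow> (nat \<Rightarrow> nat) set" where
  "multi_indices k Xi = (\<Pi>\<^sub>E i\<in>{1..k}. {1..card (Xi i)})"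

definition restricted_cost ::
  "nat \<Rightarrow> (nat \<Rightarrow> real) \<Rightarrow> (nat \<Rightarrow> nat \<Rightarrow> real ^ 'd) \<Rightarrow> (real ^ 'd) set \<Rightarrow> (nat \<Rightarrow> nat) \<Rightarrow> real" where
  "restricted_cost k lam x S j = Min (bary_cost k lam (\<lambda>i. x i (j i)) ` S)"

definition dual_feasible ::
  "nat \<Rightarrow> (nat \<Rightarrow> real) \<Rightarrow> (nat \<Rightarrow> (real ^ 'd) set) \<Rightarrow> (nat \<Rightarrow> nat \<Rightarrow> real ^ 'd) \<Rightarrow>
   (real ^ 'd) set \<Rightarrow> (nat \<Rightarrow> nat \<Rightarrow> real) \<Rightarrow> bool" where
  "dual_feasible k lam Xi x S g \<longleftrightarrow>
     (\<forall>j\<in>multi_indices k Xi. restricted_cost k lam x S j - (\<Sum>i\<in>{1..k}. g i (j i)) \<ge> 0)"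

definition dual_objective ::
  "nat \<Rightarrow> (nat \<Rightarrow> (real ^ 'd) set) \<Rightarrow> (nat \<Rightarrow> nat \<Rightarrow> real) \<Rightarrow> (nat \<Rightarrow> nat \<Rightarrow> real) \<Rightarrow> real" where
  "dual_objective k Xi p g = (\<Sum>i\<in>{1..k}. \<Sum>j\<in>{1..card (Xi i)}. p i j * g i j)"

text \<open>
  The maximum of the dual linear program is written as a supremum. For probability weights \<open>p\<close>
  and nonempty finite \<open>S\<close> the program is feasible and bounded (lemmas \<open>dual_feasible_zero\<close> and
  \<open>dual_objective_le\<close> below), so, being a finite linear program, it attains its supremum.
\<close>

definition restricted_value ::
  "nat \<Rightarrow> (nat \<Rightarrow> real) \<Rightarrow> (nat \<Rightarrow> (real ^ 'd) set) \<Rightarrow> (nat \<Rightarrow> nat \<Rightarrow> real ^ 'd) \<Rightarrow>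
   (nat \<Rightarrow> nat \<Rightarrow> real) \<Rightarrow> (real ^ 'd) set \<Rightarrow> real" where
  "restricted_value k lam Xi x p S =
     (SUP g\<in>{g. dual_feasible k lam Xi x S g}. dual_objective k Xi p g)"

definition exact_support ::
  "nat \<Rightarrow> (nat \<Rightarrow> real) \<Rightarrow> (nat \<Rightarrow> (real ^ 'd) set) \<Rightarrow> (real ^ 'd) set" where
  "exact_support k lam Xi =
     (\<Union>y\<in>(\<Pi>\<^sub>E i\<in>{1..k}. Xi i). {w. is_arg_min (bary_cost k lam y) (\<lambda>_. True) w})"

lemma bary_cost_nonneg:
  assumes "\<And>i. i \<in> {1..k} \<Longrightarrow> lam i \<ge> 0"
  shows "bary_cost k lam y w \<ge> 0"
  unfolding bary_cost_def using assms by (intro sum_nonneg mult_nonneg_nonneg) auto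

lemma bary_cost_decomp:
  assumes "(\<Sum>i\<in>{1..k}. lam i) = 1"
  defines "b \<equiv> \<lambda>y. (\<Sum>i\<in>{1..k}. lam i *\<^sub>R y i)"
  shows "bary_cost k lam y w = bary_cost k lam y (b y) + (norm (w - b y))\<^sup>2"
proof -
  have expand: "bary_cost k lam y v =
      (\<Sum>i\<in>{1..k}. lam i * (y i \<bullet> y i)) - 2 * (b y \<bullet> v) + v \<bullet> v" for v
  proof -
    have "bary_cost k lam y v =
        (\<Sum>i\<in>{1..k}. lam i * (y i \<bullet> y i) - 2 * ((lam i *\<^sub>R y i) \<bullet> v) + lam i * (v \<bullet> v))"
      unfolding bary_cost_def
    proof (intro sum.cong refl)
      fix i
      have n: "(norm (y i - v))\<^sup>2 = y i \<bullet> y i - 2 * (y i \<bullet> v) + v \<bullet> v"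
        by (simp add: power2_norm_eq_inner inner_diff_left inner_diff_right inner_commute)
      show "lam i * (norm (y i - v))\<^sup>2 =
          lam i * (y i \<bullet> y i) - 2 * ((lam i *\<^sub>R y i) \<bullet> v) + lam i * (v \<bullet> v)"
        unfolding n by (simp add: algebra_simps)
    qed
    also have "\<dots> = (\<Sum>i\<in>{1..k}. lam i * (y i \<bullet> y i)) - 2 * (b y \<bullet> v) + v \<bullet> v"
      unfolding b_def inner_sum_left
      by (simp only: sum.distrib sum_subtractf sum_distrib_left[symmetric]
          sum_distrib_right[symmetric] assms(1) mult_1)
    finally show ?thesis .
  qed
  show ?thesis
    unfolding expand power2_norm_eq_inner
    by (simp add: inner_diff_left inner_diff_right inner_commute[of w "b y"])
qed

lemma is_arg_min_bary_cost_iff: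
  assumes "(\<Sum>i\<in>{1..k}. lam i) = 1"
  shows "is_arg_min (bary_cost k lam y) (\<lambda>_. True) w \<longleftrightarrow> w = (\<Sum>i\<in>{1..k}. lam i *\<^sub>R y i)"
proof -
  let ?b = "\<Sum>i\<in>{1..k}. lam i *\<^sub>R y i"
  have d: "bary_cost k lam y v = bary_cost k lam y ?b + (norm (v - ?b))\<^sup>2" for v
    by (rule bary_cost_decomp[OF assms])
  have le: "bary_cost k lam y ?b \<le> bary_cost k lam y v" for v
    using d[of v] by simp
  have lt: "bary_cost k lam y ?b < bary_cost k lam y v" if "v \<noteq> ?b" for v
    using d[of v] that by simp
  show ?thesis
    unfolding is_arg_min_def by (metis le lt not_le)
qed

lemma exact_support_eq:
  assumes "(\<Sum>i\<in>{1..k}. lam i) = 1"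
  shows "exact_support k lam Xi =
    (\<lambda>y. \<Sum>i\<in>{1..k}. lam i *\<^sub>R y i) ` (\<Pi>\<^sub>E i\<in>{1..k}. Xi i)"
  unfolding exact_support_def is_arg_min_bary_cost_iff[OF assms] by auto

lemma dual_feasible_zero:
  assumes "\<And>i. i \<in> {1..k} \<Longrightarrow> lam i \<ge> 0" and "finite S" and "S \<noteq> {}"
  shows "dual_feasible k lam Xi x S (\<lambda>i j. 0)"
  unfolding dual_feasible_def restricted_cost_def
  using assms bary_cost_nonneg[of k lam] by auto

lemma dual_objective_le:
  assumes p_nonneg: "\<And>i j. i \<in> {1..k} \<Longrightarrow> j \<in> {1..card (Xi i)} \<Longrightarrow> p i j \<ge> 0"
    and p_sum: "\<And>i. i \<in> {1..k} \<Longrightarrow> (\<Sum>j\<in>{1..card (Xi i)}. p i j) = 1"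
    and feas: "dual_feasible k lam Xi x S g"
    and C: "\<And>j. j \<in> multi_indices k Xi \<Longrightarrow> restricted_cost k lam x S j \<le> C"
  shows "dual_objective k Xi p g \<le> C"
proof -
  define J where "J i = (SOME j. j \<in> {1..card (Xi i)} \<and>
      (\<forall>l\<in>{1..card (Xi i)}. g i l \<le> g i j))" for i
  have J: "J i \<in> {1..card (Xi i)} \<and> (\<forall>l\<in>{1..card (Xi i)}. g i l \<le> g i (J i))"
    if i: "i \<in> {1..k}" for i
  proof -
    have ne: "{1..card (Xi i)} \<noteq> {}"
      using p_sum[OF i] by (intro notI) (simp only: sum.empty)
    have "Max (g i ` {1..card (Xi i)}) \<in> g i ` {1..card (Xi i)}"
      using ne by (intro Max_in) simp_all
    then obtain j where j: "j \<in> {1..card (Xi i)}" "Max (g i ` {1..card (Xi i)}) = g i j"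
      by blast
    have "g i l \<le> g i j" if "l \<in> {1..card (Xi i)}" for l
      unfolding j(2)[symmetric] using that by (intro Max_ge) simp_all
    then have "j \<in> {1..card (Xi i)} \<and> (\<forall>l\<in>{1..card (Xi i)}. g i l \<le> g i j)"
      using j(1) by blast
    then show ?thesis
      unfolding J_def by (rule someI)
  qed
  have mem: "restrict J {1..k} \<in> multi_indices k Xi"
    unfolding multi_indices_def using J by (subst restrict_PiE_iff) blast
  have "(\<Sum>j\<in>{1..card (Xi i)}. p i j * g i j) \<le> g i (J i)" if i: "i \<in> {1..k}" for i
  proof -
    have "(\<Sum>j\<in>{1..card (Xi i)}. p i j * g i j) \<le> (\<Sum>j\<in>{1..card (Xi i)}. p i j * g i (J i))"
    proof (rule sum_mono)
      fix j assume "j \<in> {1..card (Xi i)}"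
      then show "p i j * g i j \<le> p i j * g i (J i)"
        using J[OF i] p_nonneg[OF i] by (blast intro: mult_left_mono)
    qed
    also have "\<dots> = g i (J i)"
      by (simp only: sum_distrib_right[symmetric] p_sum[OF i] mult_1)
    finally show ?thesis .
  qed
  then have "dual_objective k Xi p g \<le> (\<Sum>i\<in>{1..k}. g i (J i))"
    unfolding dual_objective_def by (rule sum_mono)
  also have "\<dots> = (\<Sum>i\<in>{1..k}. g i (restrict J {1..k} i))"
    by (intro sum.cong) simp_all
  also have "\<dots> \<le> restricted_cost k lam x S (restrict J {1..k})"
    using bspec[OF feas[unfolded dual_feasible_def] mem] by linarith
  also have "\<dots> \<le> C" by (rule C[OF mem])
  finally show ?thesis .
qed

end

theory Submission
  imports Defs
begin

text \<open>
  The value of the dual program is a superlinear function of the cost tensor, so by a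
  finite-dimensional Hahn--Banach argument it has a linear majorant that is tight at the cost tensor
  of the exact support. This majorant plays the role of an optimal transport plan: its coefficients
  are nonnegative, and taking expectations in the linear upper bound gives the theorem without
  appealing to strong duality.
\<close>

section \<open>Superlinear functionals and their linear majorants\<close>

definition superlinear :: "(('a \<Rightarrow> real) \<Rightarrow> real) \<Rightarrow> bool" where
  "superlinear V \<longleftrightarrow> (\<forall>f g. V f + V g \<le> V (\<lambda>x. f x + g x)) \<and>
     (\<forall>t f. t \<ge> 0 \<longrightarrow> t * V f \<le> V (\<lambda>x. t * f x))"

lemma superlinear_add: "superlinear V \<Longrightarrow> V f + V g \<le> V (\<lambda>x. f x + g x)"
  by (simp add: superlinear_def)

lemma superlinear_scale: "superlinear V \<Longrightarrow> t \<ge> 0 \<Longrightarrow> t * V f \<le> V (\<lambda>x. t * f x)"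
  by (simp add: superlinear_def)

lemma superlinear_zero:
  assumes "superlinear V"
  shows "V (\<lambda>x. 0) = 0"
  using superlinear_add[OF assms, of "\<lambda>x. 0" "\<lambda>x. 0"]
    superlinear_scale[OF assms, of 0 "\<lambda>x. 0"] by simp

lemma superlinear_uminus:
  assumes "superlinear V"
  shows "V f + V (\<lambda>x. - f x) \<le> 0"
  using superlinear_add[OF assms, of f "\<lambda>x. - f x"] superlinear_zero[OF assms] by simp

lemma superlinear_sum:
  assumes "superlinear V" "finite J"
  shows "(\<Sum>j\<in>J. V (f j)) \<le> V (\<lambda>x. \<Sum>j\<in>J. f j x)"
  using assms(2)
proof (induction J rule: finite_induct)
  case empty
  then show ?case by (simp add: superlinear_zero[OF assms(1)])
next
  case (insert a J)
  then show ?case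
    using superlinear_add[OF assms(1), of "f a" "\<lambda>x. \<Sum>j\<in>J. f j x"] by simp
qed

text \<open>The one-direction step of Hahn--Banach. By superadditivity
  \<open>V (f + t e) - t * V e\<close> is nondecreasing in \<open>t\<close>, and its supremum over
  \<open>t \<ge> 0\<close> defines \<open>W\<close>. Since
  \<open>V e \<le> W e \<le> - W (- e)\<close>, the last conclusion also forces
  \<open>W e = V e\<close>, so \<open>W\<close> is linear along \<open>e\<close>.\<close>

lemma superlinear_majorant_along:
  assumes V: "superlinear V"
  obtains W where "superlinear W" "\<And>f. V f \<le> W f" "W (\<lambda>x. - e x) = - V e"
proof -
  define h where "h f t = V (\<lambda>x. f x + t * e x) - t * V e" for f t
  define W where "W f = (SUP t\<in>{0..}. h f t)" for f
  have bdd: "bdd_above (h f ` {0..})" for f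
  proof (rule bdd_aboveI2)
    fix t :: real assume "t \<in> {0..}"
    \<comment> \<open>Adding \<open>- f\<close> cancels \<open>f\<close>, which leaves a bound on
      \<open>h f t\<close> that is independent of \<open>t\<close>.\<close>
    have "V (\<lambda>x. f x + t * e x) + V (\<lambda>x. - f x) \<le> V (\<lambda>x. t * e x)"
      using superlinear_add[OF V, of "\<lambda>x. f x + t * e x" "\<lambda>x. - f x"] by simp
    \<comment> \<open>The definition gives only one half of homogeneity; scaling back by
      \<open>inverse t\<close> gives the other.\<close>
    moreover have "V (\<lambda>x. t * e x) \<le> t * V e"
    proof (cases "t = 0")
      case True
      then show ?thesis by (simp add: superlinear_zero[OF V])
    next
      case False
      then have t: "t > 0" using \<open>t \<in> {0..}\<close> by simp
      have "inverse t * V (\<lambda>x. t * e x) \<le> V e"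
        using superlinear_scale[OF V, of "inverse t" "\<lambda>x. t * e x"] t
        by (simp add: mult.assoc[symmetric])
      then show ?thesis using t by (simp add: field_simps)
    qed
    ultimately show "h f t \<le> - V (\<lambda>x. - f x)"
      unfolding h_def by simp
  qed
  have upper: "h f t \<le> W f" if "t \<ge> 0" for f t
    unfolding W_def using that by (intro cSUP_upper bdd) simp
  have least: "W f \<le> B" if "\<And>t. t \<ge> 0 \<Longrightarrow> h f t \<le> B" for f B
    unfolding W_def using that by (intro cSUP_least) auto
  have add: "W f + W g \<le> W (\<lambda>x. f x + g x)" for f g
  proof -
    \<comment> \<open>The parameters add up to \<open>s + t\<close>; the suprema over
      \<open>s\<close> and \<open>t\<close> are then taken one after the other.\<close>
    have "h f s + h g t \<le> W (\<lambda>x. f x + g x)" if "s \<ge> 0" "t \<ge> 0" for s t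
    proof -
      have "h f s + h g t \<le> h (\<lambda>x. f x + g x) (s + t)"
        unfolding h_def
        using superlinear_add[OF V, of "\<lambda>x. f x + s * e x" "\<lambda>x. g x + t * e x"]
        by (simp add: algebra_simps)
      also have "\<dots> \<le> W (\<lambda>x. f x + g x)"
        using that by (intro upper) simp
      finally show ?thesis .
    qed
    then have "h f s \<le> W (\<lambda>x. f x + g x) - h g t" if "s \<ge> 0" "t \<ge> 0" for s t
      using that by (simp add: le_diff_eq)
    then have "W f \<le> W (\<lambda>x. f x + g x) - h g t" if "t \<ge> 0" for t
      using that by (intro least) simp
    then have "h g t \<le> W (\<lambda>x. f x + g x) - W f" if "t \<ge> 0" for t
      using that by (simp add: le_diff_eq add.commute)
    then have "W g \<le> W (\<lambda>x. f x + g x) - W f"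
      by (rule least)
    then show ?thesis by simp
  qed
  have VW: "V f \<le> W f" for f
    using upper[of 0 f] by (simp add: h_def)
  have scale: "r * W f \<le> W (\<lambda>x. r * f x)" if "r \<ge> 0" for r f
  proof (cases "r = 0")
    case True
    then show ?thesis using VW[of "\<lambda>x. 0"] superlinear_zero[OF V] by simp
  next
    case False
    with that have r: "r > 0" by simp
    have "h f t \<le> W (\<lambda>x. r * f x) / r" if "t \<ge> 0" for t
    proof -
      have "r * h f t \<le> h (\<lambda>x. r * f x) (r * t)"
        unfolding h_def using superlinear_scale[OF V, of r "\<lambda>x. f x + t * e x"] r
        by (simp add: algebra_simps)
      also have "\<dots> \<le> W (\<lambda>x. r * f x)"
        using r that by (intro upper) simp
      finally show ?thesis using r by (simp add: field_simps)
    qed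
    then have "W f \<le> W (\<lambda>x. r * f x) / r" by (rule least)
    then show ?thesis using r by (simp add: field_simps)
  qed
  have W: "superlinear W"
    unfolding superlinear_def using add scale by blast
  \<comment> \<open>At \<open>t = 1\<close> the argument \<open>- e + t e\<close> vanishes, so the
    supremum is at least \<open>- V e\<close>.\<close>
  have "- V e \<le> W (\<lambda>x. - e x)"
    using upper[of 1 "\<lambda>x. - e x"] by (simp add: h_def superlinear_zero[OF V])
  moreover have "W (\<lambda>x. - e x) \<le> - V e"
    using superlinear_uminus[OF W, of e] VW[of e] by simp
  ultimately show ?thesis
    using that[OF W VW] by simp
qed

text \<open>Directions are treated one at a time. Oddness already obtained survives a larger
  superlinear majorant:
  \<open>- W e \<le> - U e = U (- e) \<le> W (- e) \<le> - W e\<close>.\<close>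

lemma superlinear_majorant_odd_on:
  assumes V: "superlinear V" and "finite E"
  shows "\<exists>W. superlinear W \<and> (\<forall>f. V f \<le> W f) \<and> (\<forall>e\<in>E. W (\<lambda>x. - e x) = - W e)"
  using assms(2)
proof (induction E rule: finite_induct)
  case empty
  then show ?case using V by auto
next
  case (insert a E)
  then obtain U where U: "superlinear U" "\<And>f. V f \<le> U f" "\<And>e. e \<in> E \<Longrightarrow> U (\<lambda>x. - e x) = - U e"
    by blast
  obtain W where W: "superlinear W" "\<And>f. U f \<le> W f" "W (\<lambda>x. - a x) = - U a"
    using superlinear_majorant_along[OF U(1)] by blast
  have "W (\<lambda>x. - e x) = - W e" if "e \<in> insert a E" for e
  proof -
    have "- U e \<le> W (\<lambda>x. - e x)"
    proof (cases "e = a")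
      case True
      then show ?thesis using W(3) by simp
    next
      case False
      then show ?thesis using that U(3)[of e] W(2)[of "\<lambda>x. - e x"] by simp
    qed
    with superlinear_uminus[OF W(1), of e] W(2)[of e] show ?thesis by simp
  qed
  then show ?case
    using W(1) order_trans[OF U(2) W(2)] by blast
qed

text \<open>Making \<open>V\<close> odd along \<open>c\<close> pins the value there; making the
  result odd along the coordinate vectors \<open>d j\<close> then makes it linear on their span,
  with coefficients \<open>W (d j)\<close>. By \<open>cong\<close> only values on \<open>J\<close>
  matter, so every \<open>f\<close> may be replaced by its truncation \<open>r f\<close>, which lies
  in that span.\<close>

lemma superlinear_tight_linear_majorant:
  assumes V: "superlinear V" and J: "finite J"
    and cong: "\<And>f g. (\<And>j. j \<in> J \<Longrightarrow> f j = g j) \<Longrightarrow> V f = V g"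
  shows "\<exists>w. (\<forall>f. V f \<le> (\<Sum>j\<in>J. w j * f j)) \<and> (\<Sum>j\<in>J. w j * c j) = V c"
proof -
  define r where "r f = (\<lambda>x. if x \<in> J then f x else 0)" for f :: "'a \<Rightarrow> real"
  define d :: "'a \<Rightarrow> 'a \<Rightarrow> real" where "d j = (\<lambda>x. if x = j then 1 else 0)" for j
  have Vr: "V (r f) = V f" for f
    by (rule cong) (simp add: r_def)
  \<comment> \<open>The direction \<open>r c\<close> comes first: the later \<open>W\<close>
    dominates \<open>U\<close> at \<open>- r c\<close>, and this yields
    \<open>W (r c) \<le> V c\<close> at the end.\<close>
  obtain U where U: "superlinear U" "\<And>f. V f \<le> U f" "U (\<lambda>x. - r c x) = - V (r c)"
    using superlinear_majorant_along[OF V] by blast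
  obtain W where W: "superlinear W" "\<And>f. U f \<le> W f" "\<And>e. e \<in> d ` J \<Longrightarrow> W (\<lambda>x. - e x) = - W e"
    using superlinear_majorant_odd_on[OF U(1), of "d ` J"] J by auto
  define w where "w j = W (d j)" for j
  have scale: "a * w j \<le> W (\<lambda>x. a * d j x)" if j: "j \<in> J" for a j
  proof (cases "a \<ge> 0")
    case True
    then show ?thesis
      unfolding w_def by (rule superlinear_scale[OF W(1)])
  \<comment> \<open>For negative \<open>a\<close>, the vector \<open>- d j\<close> is scaled by
    \<open>- a\<close>, and oddness along \<open>d j\<close> restores the sign.\<close>
  next
    case False
    then show ?thesis
      using superlinear_scale[OF W(1), of "- a" "\<lambda>x. - d j x"] W(3)[of "d j"] j
      by (simp add: w_def)
  qed
  have lower: "(\<Sum>j\<in>J. w j * f j) \<le> W (r f)" for f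
  proof -
    have "(\<Sum>j\<in>J. w j * f j) \<le> (\<Sum>j\<in>J. W (\<lambda>x. f j * d j x))"
      using scale by (intro sum_mono) (simp add: mult.commute)
    also have "\<dots> \<le> W (\<lambda>x. \<Sum>j\<in>J. f j * d j x)"
      by (rule superlinear_sum[OF W(1) J])
    also have "(\<lambda>x. \<Sum>j\<in>J. f j * d j x) = r f"
      using J by (auto simp: r_def d_def fun_eq_iff if_distrib[of "\<lambda>z. _ * z"] cong: if_cong)
    finally show ?thesis .
  qed
  have r_minus: "r (\<lambda>x. - f x) = (\<lambda>x. - r f x)" for f
    by (auto simp: r_def)
  \<comment> \<open>The bound \<open>lower\<close> at \<open>- f\<close> becomes an upper bound at
    \<open>f\<close>, because \<open>W (r f) \<le> - W (- r f)\<close>.\<close>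
  have upper: "V f \<le> (\<Sum>j\<in>J. w j * f j)" for f
  proof -
    have "V f \<le> W (r f)"
      using order_trans[OF U(2) W(2), of "r f"] by (simp add: Vr)
    also have "\<dots> \<le> - W (\<lambda>x. - r f x)"
      using superlinear_uminus[OF W(1), of "r f"] by simp
    also have "\<dots> \<le> (\<Sum>j\<in>J. w j * f j)"
      using lower[of "\<lambda>x. - f x"] by (simp add: r_minus sum_negf)
    finally show ?thesis .
  qed
  have "(\<Sum>j\<in>J. w j * c j) \<le> W (r c)" by (rule lower)
  also have "\<dots> \<le> - W (\<lambda>x. - r c x)"
    using superlinear_uminus[OF W(1), of "r c"] by simp
  also have "\<dots> \<le> V c"
    using W(2)[of "\<lambda>x. - r c x"] U(3) by (simp add: Vr)
  finally have "(\<Sum>j\<in>J. w j * c j) = V c"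
    using upper[of c] by simp
  with upper show ?thesis
    by (intro exI[of _ w]) simp
qed

section \<open>The dual value as a function of the cost tensor\<close>

text \<open>An arbitrary tensor \<open>c\<close> replaces the restricted cost, so that the value
  becomes a functional on a vector space to which the majorant theorem applies.\<close>

definition cost_feasible ::
  "nat \<Rightarrow> (nat \<Rightarrow> (real ^ 'd) set) \<Rightarrow> ((nat \<Rightarrow> nat) \<Rightarrow> real) \<Rightarrow> (nat \<Rightarrow> nat \<Rightarrow> real) \<Rightarrow> bool" where
  "cost_feasible k Xi c g \<longleftrightarrow>
     (\<forall>j\<in>multi_indices k Xi. (\<Sum>i\<in>{1..k}. g i (j i)) \<le> c j)"

definition cost_value ::
  "nat \<Rightarrow> (nat \<Rightarrow> (real ^ 'd) set) \<Rightarrow> (nat \<Rightarrow> nat \<Rightarrow> real) \<Rightarrow> ((nat \<Rightarrow> nat) \<Rightarrow> real) \<Rightarrow> real" where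
  "cost_value k Xi p c = (SUP g\<in>{g. cost_feasible k Xi c g}. dual_objective k Xi p g)"

lemma restricted_value_eq_cost_value:
  "restricted_value k lam Xi x p S = cost_value k Xi p (restricted_cost k lam x S)"
  unfolding restricted_value_def cost_value_def dual_feasible_def cost_feasible_def by simp

lemma finite_multi_indices: "finite (multi_indices k Xi)"
  unfolding multi_indices_def by (intro finite_PiE) simp_all

lemma cost_value_cong:
  assumes "\<And>j. j \<in> multi_indices k Xi \<Longrightarrow> f j = g j"
  shows "cost_value k Xi p f = cost_value k Xi p g"
  unfolding cost_value_def cost_feasible_def using assms by simp

lemma dual_objective_add:
  "dual_objective k Xi p (\<lambda>i j. g i j + h i j) = dual_objective k Xi p g + dual_objective k Xi p h"
  unfolding dual_objective_def by (simp add: algebra_simps sum.distrib)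

lemma dual_objective_scale:
  "dual_objective k Xi p (\<lambda>i j. t * g i j) = t * dual_objective k Xi p g"
  unfolding dual_objective_def by (simp add: sum_distrib_left algebra_simps)

text \<open>Charging a constant to the first marginal alone shifts all constraints by the same
  amount; \<open>k > 0\<close> ensures that this marginal exists.\<close>

lemma sum_first_index:
  fixes k :: nat
  assumes "k > 0"
  shows "(\<Sum>i\<in>{1..k}. if i = 1 then b else 0) = (b :: real)"
  using assms by (simp add: Suc_le_eq)

lemma cost_feasible_exists:
  assumes "k > 0"
  shows "\<exists>g. cost_feasible k Xi c g"
proof -
  \<comment> \<open>Inserting 0 keeps \<open>Min\<close> well defined even if there are no
    multi-indices.\<close>
  define b where "b = Min (insert 0 (c ` multi_indices k Xi))"
  have "b \<le> c j" if "j \<in> multi_indices k Xi" for j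
    unfolding b_def using that finite_multi_indices[of k Xi] by (intro Min_le) auto
  then have "cost_feasible k Xi c (\<lambda>i j. if i = 1 then b else 0)"
    unfolding cost_feasible_def by (simp only: sum_first_index[OF assms]) blast
  then show ?thesis by blast
qed

text \<open>The objective is at most any nonnegative upper bound \<open>B\<close> of the costs:
  since the masses of the first marginal sum to 1, lowering its potential by \<open>B\<close> lowers
  the objective by exactly \<open>B\<close>.\<close>

lemma dual_objective_bdd_above:
  assumes k: "k > 0"
    and p_nonneg: "\<And>i j. i \<in> {1..k} \<Longrightarrow> j \<in> {1..card (Xi i)} \<Longrightarrow> p i j \<ge> 0"
    and p_sum: "\<And>i. i \<in> {1..k} \<Longrightarrow> (\<Sum>j\<in>{1..card (Xi i)}. p i j) = 1"
  shows "bdd_above (dual_objective k Xi p ` {g. cost_feasible k Xi c g})"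
proof (rule bdd_aboveI2)
  fix g assume "g \<in> {g. cost_feasible k Xi c g}"
  then have g: "(\<Sum>i\<in>{1..k}. g i (j i)) \<le> c j" if "j \<in> multi_indices k Xi" for j
    using that by (simp add: cost_feasible_def)
  define B where "B = Max (insert 0 (c ` multi_indices k Xi))"
  have B: "c j \<le> B" if "j \<in> multi_indices k Xi" for j
    unfolding B_def using that finite_multi_indices[of k Xi] by (intro Max_ge) auto
  define s :: "nat \<Rightarrow> nat \<Rightarrow> real" where "s i j = (if i = 1 then - B else 0)" for i j
  \<comment> \<open>Shifting by \<open>B\<close> makes \<open>g\<close> feasible for the zero cost, i.e. for vanishing weights.\<close>
  have "dual_feasible k (\<lambda>_. 0) Xi (\<lambda>_ _. 0) {0} (\<lambda>i j. g i j + s i j)"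
    unfolding dual_feasible_def
  proof
    fix j assume j: "j \<in> multi_indices k Xi"
    have "(\<Sum>i\<in>{1..k}. g i (j i) + s i (j i)) = (\<Sum>i\<in>{1..k}. g i (j i)) - B"
      unfolding s_def sum.distrib sum_first_index[OF k] by simp
    with g[OF j] B[OF j]
    show "0 \<le> restricted_cost k (\<lambda>_. 0) (\<lambda>_ _. 0 :: real ^ 'a) {0} j
        - (\<Sum>i\<in>{1..k}. g i (j i) + s i (j i))"
      by (simp add: restricted_cost_def bary_cost_def)
  qed
  then have "dual_objective k Xi p (\<lambda>i j. g i j + s i j) \<le> 0"
    by (rule dual_objective_le[rotated 2])
      (use p_nonneg p_sum in \<open>simp_all add: restricted_cost_def bary_cost_def\<close>)
  moreover have "dual_objective k Xi p s = - B"
  proof -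
    have "dual_objective k Xi p s = (\<Sum>i\<in>{1..k}. if i = 1 then - B else 0)"
      unfolding dual_objective_def s_def
    proof (intro sum.cong refl)
      fix i assume "i \<in> {1..k}"
      then show "(\<Sum>j\<in>{1..card (Xi i)}. p i j * (if i = 1 then - B else 0))
          = (if i = 1 then - B else 0)"
        by (simp only: sum_distrib_right[symmetric] p_sum mult_1)
    qed
    then show ?thesis by (simp only: sum_first_index[OF k])
  qed
  ultimately show "dual_objective k Xi p g \<le> B"
    by (simp add: dual_objective_add)
qed

lemma dual_objective_le_cost_value:
  assumes "k > 0"
    and "\<And>i j. i \<in> {1..k} \<Longrightarrow> j \<in> {1..card (Xi i)} \<Longrightarrow> p i j \<ge> 0"
    and "\<And>i. i \<in> {1..k} \<Longrightarrow> (\<Sum>j\<in>{1..card (Xi i)}. p i j) = 1"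
    and "cost_feasible k Xi c g"
  shows "dual_objective k Xi p g \<le> cost_value k Xi p c"
  unfolding cost_value_def using assms
  by (intro cSUP_upper dual_objective_bdd_above) auto

lemma cost_value_least:
  assumes "k > 0" "\<And>g. cost_feasible k Xi c g \<Longrightarrow> dual_objective k Xi p g \<le> B"
  shows "cost_value k Xi p c \<le> B"
  unfolding cost_value_def using cost_feasible_exists[OF assms(1), of Xi c] assms(2)
  by (intro cSUP_least) auto

lemma cost_value_nonneg:
  assumes "k > 0"
    and "\<And>i j. i \<in> {1..k} \<Longrightarrow> j \<in> {1..card (Xi i)} \<Longrightarrow> p i j \<ge> 0"
    and "\<And>i. i \<in> {1..k} \<Longrightarrow> (\<Sum>j\<in>{1..card (Xi i)}. p i j) = 1"
    and "\<And>j. j \<in> multi_indices k Xi \<Longrightarrow> c j \<ge> 0"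
  shows "cost_value k Xi p c \<ge> 0"
  using dual_objective_le_cost_value[of k Xi p c "\<lambda>i j. 0"] assms
  by (simp add: cost_feasible_def dual_objective_def)

text \<open>Feasible potentials for two costs add up to a feasible potential for the sum of the
  costs, nonnegative scaling preserves feasibility, and the objective is linear in the
  potential.\<close>

lemma superlinear_cost_value:
  assumes k: "k > 0"
    and p_nonneg: "\<And>i j. i \<in> {1..k} \<Longrightarrow> j \<in> {1..card (Xi i)} \<Longrightarrow> p i j \<ge> 0"
    and p_sum: "\<And>i. i \<in> {1..k} \<Longrightarrow> (\<Sum>j\<in>{1..card (Xi i)}. p i j) = 1"
  shows "superlinear (cost_value k Xi p)"
proof -
  have upper: "dual_objective k Xi p g \<le> cost_value k Xi p c" if "cost_feasible k Xi c g" for g c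
    using assms that by (intro dual_objective_le_cost_value)
  have "cost_value k Xi p f + cost_value k Xi p f' \<le> cost_value k Xi p (\<lambda>j. f j + f' j)"
    (is "_ \<le> ?R") for f f'
  proof -
    have *: "dual_objective k Xi p g + dual_objective k Xi p h \<le> ?R"
      if "cost_feasible k Xi f g" "cost_feasible k Xi f' h" for g h
      unfolding dual_objective_add[symmetric] using that
      by (intro upper) (auto simp: cost_feasible_def sum.distrib intro!: add_mono)
    \<comment> \<open>First the supremum over \<open>g\<close> with \<open>h\<close> fixed, then the
      supremum over \<open>h\<close>.\<close>
    have "cost_value k Xi p f \<le> ?R - dual_objective k Xi p h"
      if "cost_feasible k Xi f' h" for h
      using *[OF _ that] by (intro cost_value_least[OF k]) (simp add: le_diff_eq)
    then have "cost_value k Xi p f' \<le> ?R - cost_value k Xi p f"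
      by (intro cost_value_least[OF k]) (simp add: algebra_simps)
    then show ?thesis by simp
  qed
  moreover have "t * cost_value k Xi p f \<le> cost_value k Xi p (\<lambda>j. t * f j)" if "t \<ge> 0" for t f
  proof (cases "t = 0")
    \<comment> \<open>The zero tensor has nonnegative value because the zero potential is
      feasible.\<close>
    case True
    then show ?thesis using cost_value_nonneg[of k Xi p "\<lambda>j. t * f j"] assms by simp
  next
    case False
    with that have t: "t > 0" by simp
    have "dual_objective k Xi p g \<le> cost_value k Xi p (\<lambda>j. t * f j) / t"
      if "cost_feasible k Xi f g" for g
    proof -
      have "t * dual_objective k Xi p g \<le> cost_value k Xi p (\<lambda>j. t * f j)"
        unfolding dual_objective_scale[symmetric] using that t
        by (intro upper) (auto simp: cost_feasible_def sum_distrib_left[symmetric])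
      then show ?thesis using t by (simp add: field_simps)
    qed
    then have "cost_value k Xi p f \<le> cost_value k Xi p (\<lambda>j. t * f j) / t"
      by (rule cost_value_least[OF k])
    then show ?thesis using t by (simp add: field_simps)
  qed
  ultimately show ?thesis
    unfolding superlinear_def by blast
qed

text \<open>The weights \<open>w\<close> act as an optimal transport plan for the cost
  \<open>c\<close>.\<close>

lemma cost_value_tight_majorant:
  assumes k: "k > 0"
    and p_nonneg: "\<And>i j. i \<in> {1..k} \<Longrightarrow> j \<in> {1..card (Xi i)} \<Longrightarrow> p i j \<ge> 0"
    and p_sum: "\<And>i. i \<in> {1..k} \<Longrightarrow> (\<Sum>j\<in>{1..card (Xi i)}. p i j) = 1"
  shows "\<exists>w. (\<forall>j\<in>multi_indices k Xi. w j \<ge> 0) \<and>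
    (\<forall>f. cost_value k Xi p f \<le> (\<Sum>j\<in>multi_indices k Xi. w j * f j)) \<and>
    (\<Sum>j\<in>multi_indices k Xi. w j * c j) = cost_value k Xi p c"
proof -
  have V: "superlinear (cost_value k Xi p)"
    using assms by (intro superlinear_cost_value)
  have "\<exists>w. (\<forall>f. cost_value k Xi p f \<le> (\<Sum>j\<in>multi_indices k Xi. w j * f j)) \<and>
    (\<Sum>j\<in>multi_indices k Xi. w j * c j) = cost_value k Xi p c"
    by (rule superlinear_tight_linear_majorant[OF V finite_multi_indices]) (rule cost_value_cong)
  then obtain w where
    w: "(\<forall>f. cost_value k Xi p f \<le> (\<Sum>j\<in>multi_indices k Xi. w j * f j)) \<and>
      (\<Sum>j\<in>multi_indices k Xi. w j * c j) = cost_value k Xi p c" ..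
  have "w j \<ge> 0" if j: "j \<in> multi_indices k Xi" for j
  proof -
    \<comment> \<open>Testing the majorant on the indicator of \<open>j\<close>, a nonnegative cost,
      isolates the coefficient \<open>w j\<close>.\<close>
    have "0 \<le> cost_value k Xi p (\<lambda>l. if l = j then 1 else 0)"
      using assms by (intro cost_value_nonneg) auto
    also have "\<dots> \<le> (\<Sum>l\<in>multi_indices k Xi. w l * (if l = j then 1 else 0))"
      using w by blast
    also have "\<dots> = w j"
      using j finite_multi_indices[of k Xi] by (simp add: if_distrib[of "\<lambda>z. _ * z"] cong: if_cong)
    finally show ?thesis .
  qed
  with w show ?thesis
    by (intro exI[of _ w]) simp
qed

section \<open>The exact support and the bound in expectation\<close>

lemma finite_exact_support:
  assumes "(\<Sum>i\<in>{1..k}. lam i) = 1" "\<And>i. i \<in> {1..k} \<Longrightarrow> finite (Xi i)"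
  shows "finite (exact_support k lam Xi)"
  unfolding exact_support_eq[OF assms(1)] using assms(2) by (intro finite_imageI finite_PiE) auto

lemma exact_support_nonempty:
  assumes "(\<Sum>i\<in>{1..k}. lam i) = 1" "\<And>i. i \<in> {1..k} \<Longrightarrow> Xi i \<noteq> {}"
  shows "exact_support k lam Xi \<noteq> {}"
  unfolding exact_support_eq[OF assms(1)] using assms(2) by (simp add: PiE_eq_empty_iff)

lemma Min_bary_cost_nonneg:
  assumes "\<And>i. i \<in> {1..k} \<Longrightarrow> lam i \<ge> 0" "finite S" "S \<noteq> {}"
  shows "Min (bary_cost k lam y ` S) \<ge> 0"
  using assms by (auto intro: bary_cost_nonneg)

text \<open>Links the unrestricted minimum in the hypothesis on the random support to the cost
  restricted to the exact support. Nonnegativity of the cost makes the infimum over all points a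
  genuine lower bound.\<close>

lemma INF_bary_cost_le_Min:
  assumes "\<And>i. i \<in> {1..k} \<Longrightarrow> lam i \<ge> 0" "finite S" "S \<noteq> {}"
  shows "(INF w. bary_cost k lam y w) \<le> Min (bary_cost k lam y ` S)"
proof -
  have "bdd_below (range (bary_cost k lam y))"
    using bary_cost_nonneg[OF assms(1)] by (intro bdd_belowI2[of _ 0]) auto
  then show ?thesis
    using assms(2,3) by (auto intro: cINF_lower)
qed

theorem theorem1:
  fixes k n :: nat
    and lam :: "nat \<Rightarrow> real"
    and Xi :: "nat \<Rightarrow> (real ^ 'd) set"
    and x :: "nat \<Rightarrow> nat \<Rightarrow> real ^ 'd"
    and p :: "nat \<Rightarrow> nat \<Rightarrow> real"
    and M :: "'w measure"
    and S :: "'w \<Rightarrow> (real ^ 'd) set"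
    and \<alpha> :: real
  assumes lam_nonneg: "\<And>i. i \<in> {1..k} \<Longrightarrow> lam i \<ge> 0"
    and lam_sum: "(\<Sum>i\<in>{1..k}. lam i) = 1"
    and Xi_finite: "\<And>i. i \<in> {1..k} \<Longrightarrow> finite (Xi i)"
    and Xi_nonempty: "\<And>i. i \<in> {1..k} \<Longrightarrow> Xi i \<noteq> {}"
    and Xi_card: "\<And>i. i \<in> {1..k} \<Longrightarrow> card (Xi i) \<le> n"
    and x_enum: "\<And>i. i \<in> {1..k} \<Longrightarrow> bij_betw (x i) {1..card (Xi i)} (Xi i)"
    and p_nonneg: "\<And>i j. i \<in> {1..k} \<Longrightarrow> j \<in> {1..card (Xi i)} \<Longrightarrow> p i j \<ge> 0"
    and p_sum: "\<And>i. i \<in> {1..k} \<Longrightarrow> (\<Sum>j\<in>{1..card (Xi i)}. p i j) = 1"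
    and M: "prob_space M"
    and S_finite: "\<And>\<omega>. \<omega> \<in> space M \<Longrightarrow> finite (S \<omega>)"
    and S_nonempty: "\<And>\<omega>. \<omega> \<in> space M \<Longrightarrow> S \<omega> \<noteq> {}"
    and value_measurable: "(\<lambda>\<omega>. restricted_value k lam Xi x p (S \<omega>)) \<in> borel_measurable M"
    and alpha_nonneg: "\<alpha> \<ge> 0"
    and cost_integrable: "\<And>y. (\<And>i. i \<in> {1..k} \<Longrightarrow> y i \<in> Xi i) \<Longrightarrow>
      integrable M (\<lambda>\<omega>. Min (bary_cost k lam y ` S \<omega>))"
    and cost_bound: "\<And>y. (\<And>i. i \<in> {1..k} \<Longrightarrow> y i \<in> Xi i) \<Longrightarrow>
      prob_space.expectation M (\<lambda>\<omega>. Min (bary_cost k lam y ` S \<omega>))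
        \<le> (1 + \<alpha>) * (INF w. bary_cost k lam y w)"
  shows "integrable M (\<lambda>\<omega>. restricted_value k lam Xi x p (S \<omega>)) \<and>
    prob_space.expectation M (\<lambda>\<omega>. restricted_value k lam Xi x p (S \<omega>))
      \<le> (1 + \<alpha>) * restricted_value k lam Xi x p (exact_support k lam Xi)"
proof -
  \<comment> \<open>For \<open>k = 0\<close> the weights would sum to 0 instead of 1.\<close>
  have k: "k > 0"
    using lam_sum by (cases k) auto
  let ?J = "multi_indices k Xi"
  let ?S' = "exact_support k lam Xi"
  let ?C = "restricted_cost k lam x"
  let ?v = "\<lambda>\<omega>. restricted_value k lam Xi x p (S \<omega>)"
  \<comment> \<open>The majorant is tight at the cost of the exact support, so \<open>w\<close> is
    deterministic and can be pulled out of the expectation.\<close>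
  have "\<exists>w. (\<forall>j\<in>?J. w j \<ge> 0) \<and>
      (\<forall>f. cost_value k Xi p f \<le> (\<Sum>j\<in>?J. w j * f j)) \<and>
      (\<Sum>j\<in>?J. w j * ?C ?S' j) = cost_value k Xi p (?C ?S')"
    using k p_nonneg p_sum by (intro cost_value_tight_majorant)
  then obtain w where "(\<forall>j\<in>?J. w j \<ge> 0) \<and>
      (\<forall>f. cost_value k Xi p f \<le> (\<Sum>j\<in>?J. w j * f j)) \<and>
      (\<Sum>j\<in>?J. w j * ?C ?S' j) = cost_value k Xi p (?C ?S')" ..
  then have w: "\<And>j. j \<in> ?J \<Longrightarrow> w j \<ge> 0"
    "\<And>f. cost_value k Xi p f \<le> (\<Sum>j\<in>?J. w j * f j)"
    "(\<Sum>j\<in>?J. w j * ?C ?S' j) = cost_value k Xi p (?C ?S')"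
    by blast+
  have mem: "x i (j i) \<in> Xi i" if "j \<in> ?J" "i \<in> {1..k}" for i j
    using bij_betwE[OF x_enum[OF that(2)]] that unfolding multi_indices_def by auto
  have int: "integrable M (\<lambda>\<omega>. ?C (S \<omega>) j)" if "j \<in> ?J" for j
    unfolding restricted_cost_def by (rule cost_integrable) (rule mem[OF that])
  have exp: "(\<integral>\<omega>. ?C (S \<omega>) j \<partial>M) \<le> (1 + \<alpha>) * ?C ?S' j" if "j \<in> ?J" for j
  proof -
    let ?y = "\<lambda>i. x i (j i)"
    have "(\<integral>\<omega>. ?C (S \<omega>) j \<partial>M) \<le> (1 + \<alpha>) * (INF w. bary_cost k lam ?y w)"
      unfolding restricted_cost_def by (rule cost_bound) (rule mem[OF that])
    also have "\<dots> \<le> (1 + \<alpha>) * ?C ?S' j"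
      unfolding restricted_cost_def using alpha_nonneg
      by (intro mult_left_mono INF_bary_cost_le_Min lam_nonneg finite_exact_support
          exact_support_nonempty lam_sum Xi_finite Xi_nonempty) auto
    finally show ?thesis .
  qed
  have int_sum: "integrable M (\<lambda>\<omega>. \<Sum>j\<in>?J. w j * ?C (S \<omega>) j)"
    using int by (intro Bochner_Integration.integrable_sum integrable_mult_right)
  \<comment> \<open>The same \<open>w\<close> bounds the value for every cost tensor, hence for
    every outcome.\<close>
  have upper: "?v \<omega> \<le> (\<Sum>j\<in>?J. w j * ?C (S \<omega>) j)" for \<omega>
    unfolding restricted_value_eq_cost_value by (rule w(2))
  \<comment> \<open>Integrability of the value follows by squeezing it between 0 and the integrable
    linear bound.\<close>
  have nonneg: "?v \<omega> \<ge> 0" if "\<omega> \<in> space M" for \<omega>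
    unfolding restricted_value_eq_cost_value
    by (intro cost_value_nonneg k p_nonneg p_sum)
      (auto simp: restricted_cost_def intro!: Min_bary_cost_nonneg lam_nonneg
        S_finite[OF that] S_nonempty[OF that])
  have int_v: "integrable M ?v"
    using int_sum value_measurable
  proof (rule Bochner_Integration.integrable_bound)
    show "AE \<omega> in M. norm (?v \<omega>) \<le> norm (\<Sum>j\<in>?J. w j * ?C (S \<omega>) j)"
      using nonneg upper by (intro AE_I2) (simp add: abs_le_iff order_trans[OF _ abs_ge_self])
  qed
  have "(\<integral>\<omega>. ?v \<omega> \<partial>M) \<le> (\<integral>\<omega>. (\<Sum>j\<in>?J. w j * ?C (S \<omega>) j) \<partial>M)"
    by (rule integral_mono[OF int_v int_sum upper])
  also have "\<dots> = (\<Sum>j\<in>?J. w j * (\<integral>\<omega>. ?C (S \<omega>) j \<partial>M))"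
    using int by (subst Bochner_Integration.integral_sum) auto
  \<comment> \<open>Nonnegative weights let the bound for each multi-index be summed; tightness of
    \<open>w\<close> then turns the sum into the exact value.\<close>
  also have "\<dots> \<le> (\<Sum>j\<in>?J. w j * ((1 + \<alpha>) * ?C ?S' j))"
    using w(1) exp by (intro sum_mono mult_left_mono)
  also have "\<dots> = (1 + \<alpha>) * (\<Sum>j\<in>?J. w j * ?C ?S' j)"
    by (simp add: sum_distrib_left mult.left_commute)
  also have "\<dots> = (1 + \<alpha>) * restricted_value k lam Xi x p ?S'"
    unfolding w(3) restricted_value_eq_cost_value ..
  finally show ?thesis
    using int_v by blast
qed

end
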